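(* A permutation $w\in\mathfrak S_n$ can be decomposed, as a word, as $w=a_1\cdots a_kb_1\cdots b_{n-k}$ for some $0\le k\le n$ such that $a_i<b_j$ for all $i$ and $j$ and both $a_1\cdots a_k$ and $b_1\cdots b_{n-k}$ avoid $2143$, if and only if $w$ avoids the nine patterns $24153$, $25143$, $31524$, $31542$, $32514$, $32541$, $42153$, $52143$ and $214365$.
   Context: $\mathfrak S_n$ is the group of permutations of $\{1,\dots,n\}$, written as words $w=w_1\cdots w_n$ with $w_i=w(i)$. A word $x_1\cdots x_m$ with distinct integer entries contains a pattern $p=p_1\cdots p_l\in\mathfrak S_l$ if there are indices $i_1<\cdots<i_l$ such that $x_{i_1}\cdots x_{i_l}$ is order-isomorphic to $p$ (i.e. $x_{i_s}<x_{i_t}$ iff $p_s<p_t$); otherwise it avoids $p$. *)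

theory Defs
  imports "HOL-Combinatorics.Permutations"
begin

text \<open>
  A permutation of \<open>{1..n}\<close> is a function \<open>w\<close> with \<open>w permutes {1..n}\<close>; as a word it is the list
  of its values \<open>w 1, \<dots>, w n\<close>. Lists are indexed from 0, so \<open>w i\<close> is the letter
  \<open>one_line n w ! (i - 1)\<close>.
\<close>

definition one_line :: "nat \<Rightarrow> (nat \<Rightarrow> nat) \<Rightarrow> nat list" where
  "one_line n w = map w [1..<Suc n]"

text \<open>
  Pattern containment is meant for words \<open>x\<close> with distinct entries and for patterns \<open>p\<close> that are
  words of permutations. The function \<open>f\<close> lists the positions \<open>i\<^sub>1 < \<dots> < i\<^sub>l\<close> of an occurrence.
\<close>

definition contains_pattern :: "'a::linorder list \<Rightarrow> nat list \<Rightarrow> bool" where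
  "contains_pattern x p \<longleftrightarrow>
     (\<exists>f :: nat \<Rightarrow> nat.
        strict_mono_on {..<length p} f \<and>
        (\<forall>s<length p. f s < length x) \<and>
        (\<forall>s<length p. \<forall>t<length p. x ! f s < x ! f t \<longleftrightarrow> p ! s < p ! t))"

definition avoids_pattern :: "'a::linorder list \<Rightarrow> nat list \<Rightarrow> bool" where
  "avoids_pattern x p \<longleftrightarrow> \<not> contains_pattern x p"

end

theory Submission
  imports Defs
begin

text \<open>
  Call \<open>k\<close> a cut of a word if each of the first \<open>k\<close> letters is smaller than each later one; the
  decompositions in question are the cuts for which both parts avoid 2143. Draw the inversion graph
  of the word, whose edges are the pairs of letters in the wrong order. A cut never separates the
  two ends of an edge. An occurrence of 2143 is a pair of edges, one to the lower left of the other.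
  The eight patterns of length 5 are exactly the ways in which one further letter can be adjacent to
  both edges of an occurrence (\<open>linked_iff_contains_linking_pattern\<close>). This explains one direction:
  both edges of an occurrence that is linked in this way lie on one side of every cut, and of the
  three edges of 214365 two lie on the same side.

  Conversely, suppose that no occurrence is linked. Then a cut separates the two edges of each
  occurrence (\<open>cut_between_edges\<close>). Take the longest cut whose first part avoids 2143. If the
  second part had an occurrence of 2143, a cut between its two edges would give a longer first
  part, which contains 2143 by maximality; together with the upper edge of the occurrence in the
  second part this is an occurrence of 214365.
\<close>

section \<open>Occurrences of patterns\<close>

lemma contains_pattern_iff_positions:
  "contains_pattern x p \<longleftrightarrow>
     (\<exists>ps. length ps = length p \<and> sorted_wrt (<) ps \<and> (\<forall>i\<in>set ps. i < length x) \<and>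
        (\<forall>s<length p. \<forall>t<length p. x ! (ps ! s) < x ! (ps ! t) \<longleftrightarrow> p ! s < p ! t))"
  (is "_ \<longleftrightarrow> (\<exists>ps. ?occ ps)")
proof
  assume "contains_pattern x p"
  then obtain f where "strict_mono_on {..<length p} f" "\<forall>s<length p. f s < length x"
    "\<forall>s<length p. \<forall>t<length p. x ! f s < x ! f t \<longleftrightarrow> p ! s < p ! t"
    unfolding contains_pattern_def by blast
  then have "?occ (map f [0..<length p])"
    by (auto simp: sorted_wrt_iff_nth_less strict_mono_on_def)
  then show "\<exists>ps. ?occ ps" by (rule exI[of ?occ])
next
  assume "\<exists>ps. ?occ ps"
  then obtain ps where ps: "?occ ps" by (rule exE[of ?occ])
  then have "strict_mono_on {..<length p} (\<lambda>s. ps ! s)" "\<forall>s<length p. ps ! s < length x"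
    by (auto simp: sorted_wrt_iff_nth_less strict_mono_on_def)
  with ps show "contains_pattern x p"
    unfolding contains_pattern_def by blast
qed

text \<open>
  Comparing all pairs of letters of an occurrence is wasteful: it is enough that the letters
  increase when read in the order of the values of the pattern. The list \<open>qs\<close> is the word of the
  inverse permutation of \<open>p\<close>, with positions counted from 0. For a concrete pattern the right-hand
  side is a chain of inequalities between positions and one between letters.
\<close>

lemma contains_pattern_iff_increasing:
  assumes qs: "set qs = set [0..<length p]" "successively (<) (map ((!) p) qs)"
  shows "contains_pattern x p \<longleftrightarrow>
    (\<exists>ps. length ps = length p \<and> successively (<) ps \<and> (\<forall>i\<in>set ps. i < length x) \<and>
       successively (<) (map (\<lambda>s. x ! (ps ! s)) qs))"
proof -
  note [simp] = successively_conv_sorted_wrt[OF transp_on_less]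
  have mono_iff: "f (qs ! i) < f (qs ! j) \<longleftrightarrow> i < j"
    if "sorted_wrt (<) (map f qs)" "i < length qs" "j < length qs"
    for f :: "nat \<Rightarrow> 'b::linorder" and i j
    using that
    by (cases i j rule: linorder_cases) (auto simp: sorted_wrt_iff_nth_less dest: less_asym)
  have "(\<forall>s<length p. \<forall>t<length p. y s < y t \<longleftrightarrow> p ! s < p ! t) \<longleftrightarrow> sorted_wrt (<) (map y qs)"
    (is "?iso \<longleftrightarrow> ?sorted") for y :: "nat \<Rightarrow> 'a"
  proof
    assume iso: ?iso
    have "qs ! i < length p" if "i < length qs" for i
      using nth_mem[OF that] qs(1) by simp
    with iso qs(2) show ?sorted by (simp add: sorted_wrt_iff_nth_less)
  next
    assume sorted: ?sorted
    have index: "\<exists>i<length qs. qs ! i = s" if "s < length p" for s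
    proof -
      have "s \<in> set qs" using that qs(1) by simp
      then show ?thesis by (simp add: in_set_conv_nth)
    qed
    have sorted_p: "sorted_wrt (<) (map ((!) p) qs)"
      using qs(2) by simp
    show ?iso
    proof (intro allI impI)
      fix s t assume "s < length p" "t < length p"
      with index obtain i j where "i < length qs" "qs ! i = s" "j < length qs" "qs ! j = t"
        by blast
      with mono_iff[OF sorted] mono_iff[OF sorted_p] show "y s < y t \<longleftrightarrow> p ! s < p ! t"
        by metis
    qed
  qed
  then show ?thesis
    unfolding contains_pattern_iff_positions by simp
qed

lemma ex_list_length_Suc: "(\<exists>ps. length ps = Suc l \<and> P ps) \<longleftrightarrow> (\<exists>i ps. length ps = l \<and> P (i # ps))"
  by (metis length_Suc_conv)

definition occ_2143 :: "'a::linorder list \<Rightarrow> nat \<Rightarrow> nat \<Rightarrow> nat \<Rightarrow> nat \<Rightarrow> bool" where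
  "occ_2143 x p q r s \<longleftrightarrow> p < q \<and> q < r \<and> r < s \<and> s < length x \<and>
     x ! q < x ! p \<and> x ! p < x ! s \<and> x ! s < x ! r"

lemma contains_2143_iff: "contains_pattern x [2,1,4,3] \<longleftrightarrow> (\<exists>p q r s. occ_2143 x p q r s)"
  unfolding occ_2143_def
  by (subst contains_pattern_iff_increasing[of "[1,0,3,2]"],
      auto simp: ex_list_length_Suc simp del: ex_simps intro!: iff_exI)

lemma contains_214365_iff:
  "contains_pattern x [2,1,4,3,6,5] \<longleftrightarrow>
     (\<exists>p q r s t u. occ_2143 x p q r s \<and> occ_2143 x r s t u)"
  unfolding occ_2143_def
  by (subst contains_pattern_iff_increasing[of "[1,0,3,2,5,4]"],
      auto simp: ex_list_length_Suc simp del: ex_simps intro!: iff_exI)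

section \<open>Linked occurrences\<close>

text \<open>
  The letter at \<open>t\<close> is adjacent to both edges of the occurrence: to the letters at \<open>q\<close> and \<open>s\<close> in
  the first case and to those at \<open>p\<close> and \<open>r\<close> in the second. No other letter is adjacent to both.
\<close>

definition linked_2143 :: "'a::linorder list \<Rightarrow> nat \<Rightarrow> nat \<Rightarrow> nat \<Rightarrow> nat \<Rightarrow> nat \<Rightarrow> bool" where
  "linked_2143 x p q r s t \<longleftrightarrow> occ_2143 x p q r s \<and>
     (t < q \<and> x ! s < x ! t \<or> r < t \<and> t < length x \<and> x ! t < x ! p)"

definition linking_patterns :: "nat list set" where
  "linking_patterns = {[2,4,1,5,3], [2,5,1,4,3], [3,1,5,2,4], [3,1,5,4,2], [3,2,5,1,4],
     [3,2,5,4,1], [4,2,1,5,3], [5,2,1,4,3]}"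

lemma contains_linking_pattern_iff:
  fixes x :: "'a::linorder list"
  shows
  "contains_pattern x [2,4,1,5,3] \<longleftrightarrow> (\<exists>p t q r s. p < t \<and> t < q \<and> q < r \<and> r < s \<and> s < length x \<and>
     x!q < x!p \<and> x!p < x!s \<and> x!s < x!t \<and> x!t < x!r)"
  "contains_pattern x [2,5,1,4,3] \<longleftrightarrow> (\<exists>p t q r s. p < t \<and> t < q \<and> q < r \<and> r < s \<and> s < length x \<and>
     x!q < x!p \<and> x!p < x!s \<and> x!s < x!r \<and> x!r < x!t)"
  "contains_pattern x [3,1,5,2,4] \<longleftrightarrow> (\<exists>p q r t s. p < q \<and> q < r \<and> r < t \<and> t < s \<and> s < length x \<and>
     x!q < x!t \<and> x!t < x!p \<and> x!p < x!s \<and> x!s < x!r)"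
  "contains_pattern x [3,1,5,4,2] \<longleftrightarrow> (\<exists>p q r s t. p < q \<and> q < r \<and> r < s \<and> s < t \<and> t < length x \<and>
     x!q < x!t \<and> x!t < x!p \<and> x!p < x!s \<and> x!s < x!r)"
  "contains_pattern x [3,2,5,1,4] \<longleftrightarrow> (\<exists>p q r t s. p < q \<and> q < r \<and> r < t \<and> t < s \<and> s < length x \<and>
     x!t < x!q \<and> x!q < x!p \<and> x!p < x!s \<and> x!s < x!r)"
  "contains_pattern x [3,2,5,4,1] \<longleftrightarrow> (\<exists>p q r s t. p < q \<and> q < r \<and> r < s \<and> s < t \<and> t < length x \<and>
     x!t < x!q \<and> x!q < x!p \<and> x!p < x!s \<and> x!s < x!r)"
  "contains_pattern x [4,2,1,5,3] \<longleftrightarrow> (\<exists>t p q r s. t < p \<and> p < q \<and> q < r \<and> r < s \<and> s < length x \<and>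
     x!q < x!p \<and> x!p < x!s \<and> x!s < x!t \<and> x!t < x!r)"
  "contains_pattern x [5,2,1,4,3] \<longleftrightarrow> (\<exists>t p q r s. t < p \<and> p < q \<and> q < r \<and> r < s \<and> s < length x \<and>
     x!q < x!p \<and> x!p < x!s \<and> x!s < x!r \<and> x!r < x!t)"
  subgoal
    by (subst contains_pattern_iff_increasing[of "[2,0,4,1,3]"],
        auto simp: ex_list_length_Suc simp del: ex_simps intro!: iff_exI)
  subgoal
    by (subst contains_pattern_iff_increasing[of "[2,0,4,3,1]"],
        auto simp: ex_list_length_Suc simp del: ex_simps intro!: iff_exI)
  subgoal
    by (subst contains_pattern_iff_increasing[of "[1,3,0,4,2]"],
        auto simp: ex_list_length_Suc simp del: ex_simps intro!: iff_exI)
  subgoal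
    by (subst contains_pattern_iff_increasing[of "[1,4,0,3,2]"],
        auto simp: ex_list_length_Suc simp del: ex_simps intro!: iff_exI)
  subgoal
    by (subst contains_pattern_iff_increasing[of "[3,1,0,4,2]"],
        auto simp: ex_list_length_Suc simp del: ex_simps intro!: iff_exI)
  subgoal
    by (subst contains_pattern_iff_increasing[of "[4,1,0,3,2]"],
        auto simp: ex_list_length_Suc simp del: ex_simps intro!: iff_exI)
  subgoal
    by (subst contains_pattern_iff_increasing[of "[2,1,4,0,3]"],
        auto simp: ex_list_length_Suc simp del: ex_simps intro!: iff_exI)
  subgoal
    by (subst contains_pattern_iff_increasing[of "[2,1,4,3,0]"],
        auto simp: ex_list_length_Suc simp del: ex_simps intro!: iff_exI)
  done

text \<open>
  An additional letter links the edges from the upper left or from the lower right. On either side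
  it has two possible places among the positions and two among the values, relative to the letters
  of the occurrence; the resulting eight words are the linking patterns.
\<close>

lemma linked_iff_contains_linking_pattern:
  assumes "distinct x"
  shows "(\<exists>p q r s t. linked_2143 x p q r s t) \<longleftrightarrow> (\<exists>\<pi>\<in>linking_patterns. contains_pattern x \<pi>)"
proof
  assume "\<exists>p q r s t. linked_2143 x p q r s t"
  then obtain p q r s t where linked: "linked_2143 x p q r s t" by blast
  then have occ: "p < q" "q < r" "r < s" "s < length x" "x!q < x!p" "x!p < x!s" "x!s < x!r"
    unfolding linked_2143_def occ_2143_def by auto
  have ne: "x!i \<noteq> x!j" if "i \<noteq> j" "i < length x" "j < length x" for i j
    using that assms by (simp add: nth_eq_iff_index_eq)
  from linked have "t < q \<and> x!s < x!t \<or> r < t \<and> t < length x \<and> x!t < x!p"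
    unfolding linked_2143_def by blast
  then show "\<exists>\<pi>\<in>linking_patterns. contains_pattern x \<pi>"
  proof
    assume t: "t < q \<and> x!s < x!t"
    then have "t \<noteq> p" "x!t \<noteq> x!r" using ne[of t r] occ by auto
    then consider "t < p" "x!t < x!r" | "t < p" "x!r < x!t"
      | "p < t" "x!t < x!r" | "p < t" "x!r < x!t"
      by (meson linorder_neqE)
    then show ?thesis
    proof cases
      case 1
      then have "contains_pattern x [4,2,1,5,3]"
        unfolding contains_linking_pattern_iff using t occ by blast
      then show ?thesis unfolding linking_patterns_def by blast
    next
      case 2
      then have "contains_pattern x [5,2,1,4,3]"
        unfolding contains_linking_pattern_iff using t occ by blast
      then show ?thesis unfolding linking_patterns_def by blast
    next
      case 3
      then have "contains_pattern x [2,4,1,5,3]"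
        unfolding contains_linking_pattern_iff using t occ by blast
      then show ?thesis unfolding linking_patterns_def by blast
    next
      case 4
      then have "contains_pattern x [2,5,1,4,3]"
        unfolding contains_linking_pattern_iff using t occ by blast
      then show ?thesis unfolding linking_patterns_def by blast
    qed
  next
    assume t: "r < t \<and> t < length x \<and> x!t < x!p"
    then have "t \<noteq> s" "x!t \<noteq> x!q" using ne[of t q] occ by auto
    then consider "t < s" "x!t < x!q" | "t < s" "x!q < x!t"
      | "s < t" "x!t < x!q" | "s < t" "x!q < x!t"
      by (meson linorder_neqE)
    then show ?thesis
    proof cases
      case 1
      then have "contains_pattern x [3,2,5,1,4]"
        unfolding contains_linking_pattern_iff using t occ by blast
      then show ?thesis unfolding linking_patterns_def by blast
    next
      case 2
      then have "contains_pattern x [3,1,5,2,4]"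
        unfolding contains_linking_pattern_iff using t occ by blast
      then show ?thesis unfolding linking_patterns_def by blast
    next
      case 3
      then have "contains_pattern x [3,2,5,4,1]"
        unfolding contains_linking_pattern_iff using t occ by blast
      then show ?thesis unfolding linking_patterns_def by blast
    next
      case 4
      then have "contains_pattern x [3,1,5,4,2]"
        unfolding contains_linking_pattern_iff using t occ by blast
      then show ?thesis unfolding linking_patterns_def by blast
    qed
  qed
next
  assume "\<exists>\<pi>\<in>linking_patterns. contains_pattern x \<pi>"
  then show "\<exists>p q r s t. linked_2143 x p q r s t"
    unfolding linking_patterns_def linked_2143_def occ_2143_def
    by (simp only: bex_simps contains_linking_pattern_iff) (elim disjE exE conjE FalseE; meson less_trans)
qed

section \<open>Cuts\<close>

definition is_cut :: "'a::linorder list \<Rightarrow> nat \<Rightarrow> bool" where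
  "is_cut x k \<longleftrightarrow> k \<le> length x \<and> (\<forall>i<k. \<forall>j. k \<le> j \<and> j < length x \<longrightarrow> x ! i < x ! j)"

lemma cut_same_side:
  assumes "is_cut x k" "i < j" "j < length x" "x ! j < x ! i"
  shows "i < k \<longleftrightarrow> j < k"
  using assms unfolding is_cut_def by (meson less_asym less_trans linorder_not_less)

text \<open>
  The cut comes directly after \<open>j\<close>, the last right end of an edge to the lower left of the edge
  \<open>r, s\<close>. Suppose that a letter up to \<open>j\<close> exceeds one after \<open>j\<close>, so that they form an edge. If it
  ends before \<open>r\<close>, it lies to the lower left of \<open>r, s\<close> and contradicts the choice of \<open>j\<close>. It
  cannot end at \<open>r\<close>, whose letter is too large. If it ends after \<open>r\<close>, its right end links the
  edge \<open>r, s\<close> to an edge that ends at \<open>j\<close>.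
\<close>

lemma cut_between_edges:
  assumes "distinct x" and unlinked: "\<And>p q r s t. \<not> linked_2143 x p q r s t"
    and occ: "occ_2143 x p q r s"
  obtains k where "is_cut x k" "q < k" "k \<le> r"
proof -
  \<comment> \<open>the right ends of the edges to the lower left of the edge \<open>r, s\<close>\<close>
  define J where "J = {j. j < r \<and> (\<exists>i<j. x ! j < x ! i \<and> x ! i < x ! s)}"
  have rs: "r < s" "s < length x" "x ! s < x ! r" and "q \<in> J"
    using occ by (auto simp: J_def occ_2143_def)
  have "finite J" by (simp add: J_def)
  define j where "j = Max J"
  have "j \<in> J" "q \<le> j" and last: "\<And>j'. j' \<in> J \<Longrightarrow> j' \<le> j"
    unfolding j_def using \<open>finite J\<close> \<open>q \<in> J\<close> by (auto intro: Max_in)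
  then obtain i where ij: "i < j" "j < r" "x ! j < x ! i" "x ! i < x ! s"
    by (auto simp: J_def)
  have ne: "x ! a \<noteq> x ! b" if "a \<noteq> b" "a < length x" "b < length x" for a b
    using that assms(1) by (simp add: nth_eq_iff_index_eq)
  have edge: "occ_2143 x a j r s" if "a < j" "x ! j < x ! a" "x ! a < x ! s" for a
    using that ij rs by (simp add: occ_2143_def)
  have low: "x ! a < x ! s" if "a \<le> j" for a
  proof (cases "a = j")
    case True
    with ij show ?thesis by simp
  next
    case False
    with that unlinked[of i j r s a] edge[of i] ij have "x ! a \<le> x ! s"
      by (auto simp: linked_2143_def)
    with ne[of a s] that ij rs show ?thesis by auto
  qed
  have high: "x ! a \<le> x ! b" if "a < j" "x ! j < x ! a" "r < b" "b < length x" for a b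
    using that unlinked[of a j r s b] edge[of a] low[of a] by (auto simp: linked_2143_def)
  have "x ! a < x ! b" if "a \<le> j" "j < b" "b < length x" for a b
  proof (rule ccontr)
    assume "\<not> x ! a < x ! b"
    with ne[of a b] that have inv: "x ! b < x ! a" by auto
    consider "b < r" | "b = r" | "r < b" by linarith
    then show False
    proof cases
      case 1
      with inv that low[of a] have "b \<in> J" by (auto simp: J_def intro!: exI[of _ a])
      with last that(2) show False by fastforce
    next
      case 2
      with inv low[of a] that rs show False by auto
    next
      case 3
      \<comment> \<open>The letter at \<open>b\<close> cannot link \<open>i, j\<close> to \<open>r, s\<close>, so it exceeds the letter at \<open>j\<close>; hence
        \<open>a, j\<close> is an edge as well, and it would be linked to \<open>r, s\<close>.\<close>
      with high[of i b] ij that have "x ! j < x ! b" by auto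
      with inv that have "a < j" "x ! j < x ! a" by (auto simp: order.order_iff_strict)
      with high[of a b] 3 that inv show False by auto
    qed
  qed
  then have "is_cut x (Suc j)"
    using ij rs by (simp add: is_cut_def)
  with that \<open>q \<le> j\<close> ij(2) show thesis by auto
qed

lemma take_avoids_2143_iff:
  "avoids_pattern (take k x) [2,1,4,3] \<longleftrightarrow> (\<forall>p q r s. occ_2143 x p q r s \<longrightarrow> k \<le> s)"
proof -
  have "occ_2143 (take k x) p q r s \<longleftrightarrow> occ_2143 x p q r s \<and> s < k" for p q r s
    by (auto simp: occ_2143_def)
  then show ?thesis
    unfolding avoids_pattern_def contains_2143_iff by (simp add: not_less[symmetric])
qed

lemma drop_avoids_2143_iff:
  assumes "k \<le> length x"
  shows "avoids_pattern (drop k x) [2,1,4,3] \<longleftrightarrow> (\<forall>p q r s. occ_2143 x p q r s \<longrightarrow> p < k)"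
proof -
  have shift: "occ_2143 (drop k x) p q r s \<longleftrightarrow> occ_2143 x (k + p) (k + q) (k + r) (k + s)" for p q r s
    using assms by (auto simp: occ_2143_def)
  have "\<exists>p q r s. occ_2143 (drop k x) p q r s" if "occ_2143 x p q r s" "k \<le> p" for p q r s
  proof -
    have "k \<le> q" "k \<le> r" "k \<le> s" using that by (auto simp: occ_2143_def)
    with that have "occ_2143 (drop k x) (p - k) (q - k) (r - k) (s - k)" by (simp add: shift)
    then show ?thesis by blast
  qed
  then show ?thesis
    unfolding avoids_pattern_def contains_2143_iff by (metis linorder_not_less le_add1 shift)
qed

theorem avoiding_cut_iff:
  assumes "distinct x"
  shows "(\<exists>k. is_cut x k \<and> avoids_pattern (take k x) [2,1,4,3] \<and> avoids_pattern (drop k x) [2,1,4,3])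
    \<longleftrightarrow> (\<forall>\<pi> \<in> linking_patterns \<union> {[2,1,4,3,6,5]}. avoids_pattern x \<pi>)"
proof
  assume "\<exists>k. is_cut x k \<and> avoids_pattern (take k x) [2,1,4,3] \<and> avoids_pattern (drop k x) [2,1,4,3]"
  then obtain k where k: "is_cut x k"
    and avoids: "\<And>p q r s. occ_2143 x p q r s \<Longrightarrow> p < k \<and> k \<le> s"
    by (metis drop_avoids_2143_iff is_cut_def take_avoids_2143_iff)
  have edges: "p < k \<longleftrightarrow> q < k" "r < k \<longleftrightarrow> s < k" if "occ_2143 x p q r s" for p q r s
    using that cut_same_side[OF k, of p q] cut_same_side[OF k, of r s] by (auto simp: occ_2143_def)
  have "\<not> linked_2143 x p q r s t" for p q r s t
  proof
    assume linked: "linked_2143 x p q r s t"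
    then have occ: "occ_2143 x p q r s" by (simp add: linked_2143_def)
    \<comment> \<open>\<open>t\<close> is on the side of \<open>q\<close> and \<open>s\<close>, or on the side of \<open>p\<close> and \<open>r\<close>.\<close>
    from linked have "q < k \<longleftrightarrow> s < k"
      unfolding linked_2143_def occ_2143_def
      using cut_same_side[OF k, of t q] cut_same_side[OF k, of t s]
        cut_same_side[OF k, of p t] cut_same_side[OF k, of r t]
        edges[OF occ]
      by auto
    with avoids[OF occ] edges[OF occ] show False by linarith
  qed
  moreover have "\<not> (occ_2143 x p q r s \<and> occ_2143 x r s t u)" for p q r s t u
    using avoids edges by (meson linorder_not_less)
  ultimately show "\<forall>\<pi> \<in> linking_patterns \<union> {[2,1,4,3,6,5]}. avoids_pattern x \<pi>"
    using linked_iff_contains_linking_pattern[OF assms]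
    unfolding ball_Un ball_simps avoids_pattern_def contains_214365_iff by blast
next
  assume avoids: "\<forall>\<pi> \<in> linking_patterns \<union> {[2,1,4,3,6,5]}. avoids_pattern x \<pi>"
  then have unlinked: "\<not> linked_2143 x p q r s t" for p q r s t
    using linked_iff_contains_linking_pattern[OF assms] by (auto simp: avoids_pattern_def)
  have no_three: "\<not> (occ_2143 x p q r s \<and> occ_2143 x r s t u)" for p q r s t u
    using avoids unfolding avoids_pattern_def using contains_214365_iff by blast
  \<comment> \<open>the cuts whose first part avoids 2143; the longest of them is the witness\<close>
  define K where "K = {k. is_cut x k \<and> (\<forall>p q r s. occ_2143 x p q r s \<longrightarrow> k \<le> s)}"
  have "finite K" by (rule finite_subset[of _ "{..length x}"]) (auto simp: K_def is_cut_def)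
  have "0 \<in> K" by (simp add: K_def is_cut_def)
  define k where "k = Max K"
  have "k \<in> K" and last: "\<And>k'. k' \<in> K \<Longrightarrow> k' \<le> k"
    unfolding k_def using \<open>finite K\<close> \<open>0 \<in> K\<close> by (auto intro: Max_in)
  have "p < k" if occ: "occ_2143 x p q r s" for p q r s
  proof (rule ccontr)
    assume "\<not> p < k"
    obtain k' where k': "is_cut x k'" "q < k'" "k' \<le> r"
      using cut_between_edges[OF assms unlinked occ] .
    have "k < k'" using \<open>\<not> p < k\<close> occ k'(2) by (simp add: occ_2143_def)
    then have "k' \<notin> K" using last by fastforce
    then obtain p' q' r' s' where occ': "occ_2143 x p' q' r' s'" "s' < k'"
      using k'(1) by (auto simp: K_def not_le)
    then have "x ! r' < x ! s"
      using k' occ by (simp add: is_cut_def occ_2143_def)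
    then have "occ_2143 x r' s' r s"
      using occ occ' k'(3) by (auto simp: occ_2143_def)
    with no_three occ'(1) show False by blast
  qed
  moreover have "is_cut x k" "k \<le> length x" "\<forall>p q r s. occ_2143 x p q r s \<longrightarrow> k \<le> s"
    using \<open>k \<in> K\<close> by (auto simp: K_def is_cut_def)
  ultimately show "\<exists>k. is_cut x k \<and> avoids_pattern (take k x) [2,1,4,3] \<and> avoids_pattern (drop k x) [2,1,4,3]"
    using take_avoids_2143_iff drop_avoids_2143_iff by blast
qed

section \<open>Permutations\<close>

lemma distinct_one_line:
  assumes "w permutes {1..n}"
  shows "distinct (one_line n w)"
  using permutes_inj_on[OF assms] by (simp add: one_line_def distinct_map)

theorem proposition5p6:
  fixes n :: nat and w :: "nat \<Rightarrow> nat"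
  assumes "w permutes {1..n}"
  shows "(\<exists>k\<le>n. \<exists>a b :: nat list.
            one_line n w = a @ b \<and> length a = k \<and> length b = n - k \<and>
            (\<forall>i<k. \<forall>j<n - k. a ! i < b ! j) \<and>
            avoids_pattern a [2,1,4,3] \<and> avoids_pattern b [2,1,4,3])
     \<longleftrightarrow>
         (\<forall>p \<in> {[2,4,1,5,3], [2,5,1,4,3], [3,1,5,2,4], [3,1,5,4,2], [3,2,5,1,4],
                [3,2,5,4,1], [4,2,1,5,3], [5,2,1,4,3], [2,1,4,3,6,5]}.
            avoids_pattern (one_line n w) p)"
proof -
  let ?x = "one_line n w"
  have len: "length ?x = n" by (simp add: one_line_def)
  have cut: "is_cut ?x k \<longleftrightarrow> k \<le> n \<and> (\<forall>i<k. \<forall>j<n - k. take k ?x ! i < drop k ?x ! j)" for k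
  proof -
    have "(\<forall>j. k \<le> j \<and> j < n \<longrightarrow> y < ?x ! j) \<longleftrightarrow> (\<forall>j<n - k. y < ?x ! (k + j))" for y
      by (metis add.commute le_add1 le_add_diff_inverse less_diff_conv)
    then show ?thesis by (auto simp: is_cut_def len)
  qed
  have "(\<exists>k\<le>n. \<exists>a b. ?x = a @ b \<and> length a = k \<and> length b = n - k \<and>
            (\<forall>i<k. \<forall>j<n - k. a ! i < b ! j) \<and>
            avoids_pattern a [2,1,4,3] \<and> avoids_pattern b [2,1,4,3])
     \<longleftrightarrow> (\<exists>k. is_cut ?x k \<and> avoids_pattern (take k ?x) [2,1,4,3] \<and> avoids_pattern (drop k ?x) [2,1,4,3])"
    unfolding cut
  proof (intro iffI; elim exE conjE)
    fix k a b
    assume "?x = a @ b" "length a = k" "length b = n - k" "k \<le> n" "\<forall>i<k. \<forall>j<n - k. a ! i < b ! j"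
      "avoids_pattern a [2,1,4,3]" "avoids_pattern b [2,1,4,3]"
    then show "\<exists>k. (k \<le> n \<and> (\<forall>i<k. \<forall>j<n - k. take k ?x ! i < drop k ?x ! j)) \<and>
        avoids_pattern (take k ?x) [2,1,4,3] \<and> avoids_pattern (drop k ?x) [2,1,4,3]"
      by (intro exI[of _ k]) simp
  next
    fix k
    assume k: "k \<le> n" "\<forall>i<k. \<forall>j<n - k. take k ?x ! i < drop k ?x ! j"
      "avoids_pattern (take k ?x) [2,1,4,3]" "avoids_pattern (drop k ?x) [2,1,4,3]"
    have parts: "?x = take k ?x @ drop k ?x" "length (take k ?x) = k" "length (drop k ?x) = n - k"
      using k(1) by (simp_all add: len)
    show "\<exists>k\<le>n. \<exists>a b. ?x = a @ b \<and> length a = k \<and> length b = n - k \<and>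
            (\<forall>i<k. \<forall>j<n - k. a ! i < b ! j) \<and>
            avoids_pattern a [2,1,4,3] \<and> avoids_pattern b [2,1,4,3]"
      by (rule exI[of _ k], rule conjI[OF k(1)], rule exI[of _ "take k ?x"],
          rule exI[of _ "drop k ?x"], intro conjI parts k(2-4))
  qed
  also have "\<dots> \<longleftrightarrow> (\<forall>\<pi> \<in> linking_patterns \<union> {[2,1,4,3,6,5]}. avoids_pattern ?x \<pi>)"
    by (rule avoiding_cut_iff[OF distinct_one_line[OF assms]])
  finally show ?thesis
    unfolding linking_patterns_def by (simp only: Un_insert_left Un_empty_left)
qed

end
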